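(* For any permutation $\sigma\in\mathfrak S_n$, $$V(\sigma)=2\big(N_{21}(\sigma)+N_{231}(\sigma)+N_{312}(\sigma)+N_{321}(\sigma)\big).$$
   Context: $V(\sigma)=\sum_{i=1}^n(\sigma_i-i)^2$. For a permutation $\pi\in\mathfrak S_k$, $N_\pi(\sigma)$ is the number of choices of positions $i_1<\dots<i_k$ such that $\sigma_{i_1}\cdots\sigma_{i_k}$ is order-isomorphic to $\pi$ (classical pattern count). *)

theory Defs
  imports "HOL-Combinatorics.Permutations"
begin

text \<open>
  A permutation of size \<open>n\<close> is a function \<open>\<sigma>\<close> with \<open>\<sigma> permutes {1..n}\<close>, so positions and values
  are both numbered from 1.  A pattern is a list of values in one-line notation, so the
  pattern 231 is \<open>[2, 3, 1]\<close>.
\<close>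

definition total_displacement_sq :: "nat \<Rightarrow> (nat \<Rightarrow> nat) \<Rightarrow> int" where
  "total_displacement_sq n \<sigma> = (\<Sum>i = 1..n. (int (\<sigma> i) - int i)\<^sup>2)"

definition order_isomorphic :: "nat list \<Rightarrow> nat list \<Rightarrow> bool" where
  "order_isomorphic u v \<longleftrightarrow>
     length u = length v \<and>
     (\<forall>a < length u. \<forall>b < length u. u ! a < u ! b \<longleftrightarrow> v ! a < v ! b)"

text \<open>A choice of positions \<open>i\<^sub>1 < \<dots> < i\<^sub>k\<close> is a strictly increasing list of elements of \<open>{1..n}\<close>.\<close>

definition pattern_occurrences :: "nat list \<Rightarrow> nat \<Rightarrow> (nat \<Rightarrow> nat) \<Rightarrow> nat list set" where
  "pattern_occurrences \<pi> n \<sigma> =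
     {is. length is = length \<pi> \<and> sorted_wrt (<) is \<and> set is \<subseteq> {1..n} \<and>
          order_isomorphic (map \<sigma> is) \<pi>}"

definition pattern_count :: "nat list \<Rightarrow> nat \<Rightarrow> (nat \<Rightarrow> nat) \<Rightarrow> nat" where
  "pattern_count \<pi> n \<sigma> = card (pattern_occurrences \<pi> n \<sigma>)"

end

theory Submission
  imports Defs
begin

text \<open>
  Since \<open>\<sigma>\<close> permutes \<open>{1..n}\<close>, half of \<open>V(\<sigma>)\<close> is \<open>\<Sum>j. j * (j - \<sigma> j)\<close>.  The number of inversions
  with right end \<open>j\<close> minus the number of those with left end \<open>j\<close> is \<open>j - \<sigma> j\<close>, so this is
  the sum of \<open>j - i\<close> over all inversions \<open>(i, j)\<close>.  Finally \<open>j - i\<close> is 1 plus the number of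
  positions strictly between, and putting such a position into the inversion gives an
  occurrence of exactly one of 231, 312, 321, the patterns whose outer letters form an inversion.
\<close>

definition inversions :: "nat \<Rightarrow> (nat \<Rightarrow> nat) \<Rightarrow> (nat \<times> nat) set" where
  "inversions n \<sigma> = {(i, j). i \<in> {1..n} \<and> j \<in> {1..n} \<and> i < j \<and> \<sigma> j < \<sigma> i}"

lemma finite_inversions: "finite (inversions n \<sigma>)"
  by (rule finite_subset[of _ "{1..n} \<times> {1..n}"]) (auto simp: inversions_def)

text \<open>The summand equals \<open>of_bool (i < j) - of_bool (\<sigma> i < \<sigma> j)\<close>: a
  non-inverted pair cancels, an inverted one leaves 1 or -1. Both parts then merely count smaller
  numbers.\<close>

lemma sum_inversion_difference:
  assumes \<sigma>: "\<sigma> permutes {1..n}" and j: "j \<in> {1..n}"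
  shows "(\<Sum>i = 1..n. of_bool (i < j \<and> \<sigma> j < \<sigma> i) - of_bool (j < i \<and> \<sigma> i < \<sigma> j)) = int j - int (\<sigma> j)"
proof -
  \<comment> \<open>Used for both \<open>j\<close> and \<open>\<sigma> j\<close>, so the two -1
    cancel at the end.\<close>
  have below: "(\<Sum>i = 1..n. of_bool (i < m)) = int m - 1" if "m \<in> {1..n}" for m
  proof -
    have "{1..n} \<inter> {i. i < m} = {1..<m}"
      using that by auto
    then show ?thesis
      using that by (simp add: sum_of_bool_eq)
  qed
  have "(\<Sum>i = 1..n. of_bool (i < j \<and> \<sigma> j < \<sigma> i) - of_bool (j < i \<and> \<sigma> i < \<sigma> j)) =
      (\<Sum>i = 1..n. of_bool (i < j) - of_bool (\<sigma> i < \<sigma> j) :: int)"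
  proof (rule sum.cong [OF refl])
    fix i
    show "of_bool (i < j \<and> \<sigma> j < \<sigma> i) - of_bool (j < i \<and> \<sigma> i < \<sigma> j) =
        (of_bool (i < j) - of_bool (\<sigma> i < \<sigma> j) :: int)"
      \<comment> \<open>Injectivity excludes a tie \<open>\<sigma> i = \<sigma> j\<close> with
        \<open>i \<noteq> j\<close>, where the two sides could differ.\<close>
      using inj_eq[OF permutes_inj[OF \<sigma>], of i j] by (auto simp: of_bool_def)
  qed
  also have "\<dots> = (int j - 1) - (\<Sum>i = 1..n. of_bool (\<sigma> i < \<sigma> j))"
    using below[OF j] by (simp add: sum_subtractf)
  also have "(\<Sum>i = 1..n. of_bool (\<sigma> i < \<sigma> j)) = (\<Sum>i = 1..n. of_bool (i < \<sigma> j) :: int)"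
    using sum.permute[OF \<sigma>, of "\<lambda>i. of_bool (i < \<sigma> j) :: int"] by (simp add: o_def)
  also have "\<dots> = int (\<sigma> j) - 1"
    using below permutes_in_image[OF \<sigma>] j by blast
  finally show ?thesis
    by simp
qed

lemma sum_inversions_distance:
  assumes \<sigma>: "\<sigma> permutes {1..n}"
  shows "(\<Sum>(i, j) \<in> inversions n \<sigma>. int j - int i) = (\<Sum>j = 1..n. int j * (int j - int (\<sigma> j)))"
proof -
  let ?a = "\<lambda>i j. of_bool (i < j \<and> \<sigma> j < \<sigma> i) :: int"
  \<comment> \<open>Filter form over a finite product, as \<open>sum.inter_filter\<close>
    expects.\<close>
  have inv: "inversions n \<sigma> = {p \<in> {1..n} \<times> {1..n}. fst p < snd p \<and> \<sigma> (snd p) < \<sigma> (fst p)}"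
    by (auto simp: inversions_def)
  have "(\<Sum>(i, j) \<in> inversions n \<sigma>. int j - int i) =
      (\<Sum>(i, j) \<in> {1..n} \<times> {1..n}. (int j - int i) * ?a i j)"
    unfolding inv by (subst sum.inter_filter) (auto intro!: sum.cong)
  also have "\<dots> = (\<Sum>i = 1..n. \<Sum>j = 1..n. int j * ?a i j) - (\<Sum>i = 1..n. \<Sum>j = 1..n. int i * ?a i j)"
    by (simp add: sum.cartesian_product [symmetric] sum_subtractf left_diff_distrib del: of_bool_conj)
  also have "(\<Sum>i = 1..n. \<Sum>j = 1..n. int j * ?a i j) = (\<Sum>j = 1..n. \<Sum>i = 1..n. int j * ?a i j)"
    by (rule sum.swap)
  \<comment> \<open>Exchanging the bound names in the second double sum gives both sums the weight
    \<open>j\<close>, which collects the contributions by position.\<close>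
  also have "\<dots> - (\<Sum>i = 1..n. \<Sum>j = 1..n. int i * ?a i j) =
      (\<Sum>j = 1..n. int j * (\<Sum>i = 1..n. ?a i j - ?a j i))"
    by (simp add: sum_subtractf sum_distrib_left right_diff_distrib mult.commute
        del: of_bool_conj)
  also have "\<dots> = (\<Sum>j = 1..n. int j * (int j - int (\<sigma> j)))"
    using sum_inversion_difference[OF \<sigma>] by (intro sum.cong) simp_all
  finally show ?thesis .
qed

text \<open>Expanding the square, the sums of \<open>(\<sigma> i)\<^sup>2\<close> and of
  \<open>i\<^sup>2\<close> agree, which leaves twice the sum of
  \<open>i * (i - \<sigma> i)\<close>.\<close>

lemma total_displacement_sq_eq_sum_inversions:
  assumes \<sigma>: "\<sigma> permutes {1..n}"
  shows "total_displacement_sq n \<sigma> = 2 * (\<Sum>(i, j) \<in> inversions n \<sigma>. int j - int i)"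
proof -
  have "(\<Sum>i = 1..n. (int (\<sigma> i))\<^sup>2) = (\<Sum>i = 1..n. (int i)\<^sup>2)"
    using sum.permute[OF \<sigma>, of "\<lambda>i. (int i)\<^sup>2"] by (simp add: o_def)
  then have "total_displacement_sq n \<sigma> = 2 * (\<Sum>j = 1..n. int j * (int j - int (\<sigma> j)))"
    unfolding total_displacement_sq_def
    by (simp add: power2_diff sum_subtractf sum.distrib right_diff_distrib power2_eq_square
        sum_distrib_left algebra_simps)
  then show ?thesis
    by (simp add: sum_inversions_distance[OF \<sigma>])
qed

lemma finite_pattern_occurrences: "finite (pattern_occurrences \<pi> n \<sigma>)"
  by (rule finite_subset[OF _ finite_lists_length_eq[of "{1..n}" "length \<pi>"]])
    (auto simp: pattern_occurrences_def)

lemma order_isomorphic_2: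
  "order_isomorphic [x, y] [p, q] \<longleftrightarrow> (x < y \<longleftrightarrow> p < q) \<and> (y < x \<longleftrightarrow> q < p)"
  by (auto simp: order_isomorphic_def All_less_Suc)

lemma pattern_occurrences_21:
  "pattern_occurrences [2, 1] n \<sigma> = (\<lambda>(i, j). [i, j]) ` inversions n \<sigma>"
proof -
  have "pattern_occurrences [2, 1] n \<sigma> =
      {[i, j] | i j. i < j \<and> {i, j} \<subseteq> {1..n} \<and> order_isomorphic [\<sigma> i, \<sigma> j] [2, 1]}"
    by (fastforce simp: pattern_occurrences_def length_Suc_conv)
  then show ?thesis
    by (auto simp: order_isomorphic_2 inversions_def)
qed

text \<open>The middle position is called \<open>k\<close>, so that \<open>(i, j)\<close> stays the
  outer pair as in \<open>inversions\<close>.\<close>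

lemma pattern_occurrences_3:
  "pattern_occurrences [p, q, r] n \<sigma> =
     {[i, k, j] | i k j. i < k \<and> k < j \<and> {i, k, j} \<subseteq> {1..n} \<and>
        order_isomorphic [\<sigma> i, \<sigma> k, \<sigma> j] [p, q, r]}"
  by (fastforce simp: pattern_occurrences_def length_Suc_conv)

lemma order_isomorphic_3:
  "order_isomorphic [x, y, z] [p, q, r] \<longleftrightarrow>
     (x < y \<longleftrightarrow> p < q) \<and> (x < z \<longleftrightarrow> p < r) \<and> (y < z \<longleftrightarrow> q < r) \<and>
     (y < x \<longleftrightarrow> q < p) \<and> (z < x \<longleftrightarrow> r < p) \<and> (z < y \<longleftrightarrow> r < q)"
  by (auto simp: order_isomorphic_def All_less_Suc)

lemma pattern_count_21: "pattern_count [2, 1] n \<sigma> = card (inversions n \<sigma>)"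
  unfolding pattern_count_def pattern_occurrences_21
  by (rule card_image) (auto simp: inj_on_def)

lemma pattern_count_231_312_321:
  assumes \<sigma>: "\<sigma> permutes {1..n}"
  shows "pattern_count [2, 3, 1] n \<sigma> + pattern_count [3, 1, 2] n \<sigma> + pattern_count [3, 2, 1] n \<sigma> =
    (\<Sum>(i, j) \<in> inversions n \<sigma>. j - i - 1)"
proof -
  let ?A = "pattern_occurrences [2, 3, 1] n \<sigma>"
  let ?B = "pattern_occurrences [3, 1, 2] n \<sigma>"
  let ?C = "pattern_occurrences [3, 2, 1] n \<sigma>"
  let ?S = "SIGMA p : inversions n \<sigma>. {fst p<..<snd p}"
  have neq: "\<sigma> i \<noteq> \<sigma> j" if "i < j" for i j
    using inj_eq[OF permutes_inj[OF \<sigma>], of i j] that by auto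
  have union: "?A \<union> ?B \<union> ?C = (\<lambda>((i, j), k). [i, k, j]) ` ?S"
  proof (rule set_eqI)
    fix xs
    \<comment> \<open>Given \<open>\<sigma> j < \<sigma> i\<close>, the value
      \<open>\<sigma> k\<close> lies above both (231), below both (312) or between them (321);
      \<open>neq\<close> rules out ties.\<close>
    have "xs \<in> ?A \<union> ?B \<union> ?C \<longleftrightarrow>
        (\<exists>i k j. xs = [i, k, j] \<and> i < k \<and> k < j \<and> {i, k, j} \<subseteq> {1..n} \<and> \<sigma> j < \<sigma> i)"
      unfolding pattern_occurrences_3 order_isomorphic_3
      using neq by (auto simp: not_less_iff_gr_or_eq) (metis linorder_neqE_nat)+
    also have "\<dots> \<longleftrightarrow> xs \<in> (\<lambda>((i, j), k). [i, k, j]) ` ?S"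
      by (force simp: inversions_def image_iff)
    finally show "xs \<in> ?A \<union> ?B \<union> ?C \<longleftrightarrow> xs \<in> (\<lambda>((i, j), k). [i, k, j]) ` ?S" .
  qed
  have "?A \<inter> ?B = {}" "(?A \<union> ?B) \<inter> ?C = {}"
    unfolding pattern_occurrences_3 order_isomorphic_3 by auto
  then have "card ?A + card ?B + card ?C = card (?A \<union> ?B \<union> ?C)"
    by (simp add: card_Un_disjoint finite_pattern_occurrences)
  also have "\<dots> = card ?S"
    unfolding union by (rule card_image) (auto simp: inj_on_def)
  also have "\<dots> = (\<Sum>(i, j) \<in> inversions n \<sigma>. j - i - 1)"
    \<comment> \<open>The fibre over \<open>(i, j)\<close> is an open interval with
      \<open>j - i - 1\<close> elements.\<close>
    by (simp add: card_SigmaI finite_inversions case_prod_beta)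
  finally show ?thesis
    by (simp add: pattern_count_def)
qed

theorem theorem3p4:
  fixes n :: nat and \<sigma> :: "nat \<Rightarrow> nat"
  assumes "\<sigma> permutes {1..n}"
  shows "total_displacement_sq n \<sigma> =
           2 * (int (pattern_count [2, 1] n \<sigma>) + int (pattern_count [2, 3, 1] n \<sigma>)
              + int (pattern_count [3, 1, 2] n \<sigma>) + int (pattern_count [3, 2, 1] n \<sigma>))"
proof -
  \<comment> \<open>The subtraction on naturals is exact because \<open>i < j\<close>; the 1
    accounts for the pattern 21.\<close>
  have "(\<Sum>(i, j) \<in> inversions n \<sigma>. int j - int i) =
      (\<Sum>(i, j) \<in> inversions n \<sigma>. 1 + int (j - i - 1))"
    by (rule sum.cong) (auto simp: inversions_def)
  also have "\<dots> = int (card (inversions n \<sigma>)) + int (\<Sum>(i, j) \<in> inversions n \<sigma>. j - i - 1)"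
    by (simp add: case_prod_beta sum.distrib)
  finally show ?thesis
    unfolding total_displacement_sq_eq_sum_inversions[OF assms] pattern_count_21
      pattern_count_231_312_321[OF assms, symmetric]
    by simp
qed

end
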